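(* Let $d\ge 1$, let $\pi\in\mathbb{Z}^d_{>0}$ and let $T$ be a positive integer. Let $Q=\mathbb{Z}^d\cap\{c\in\mathbb{R}^d_{\ge 0}:\pi\cdot c\le T\}$, let $b\in\mathbb{R}^d$ and $m\in\mathbb{Z}_{\ge 0}$, and consider the integer program [conf-IP]: find $x\in\mathbb{Z}_{\ge 0}^{Q}$ with $\sum_{c\in Q} c\,x_c=b$ and $\sum_{c\in Q}x_c=m$. Assume [conf-IP] is feasible. Then there exists a feasible solution $x$ of [conf-IP] such that: (1) if $x_c>1$ then the configuration $c$ is simple; (2) $|\mathrm{supp}(x)|\le 4(d+1)\log(4(d+1)T)$; (3) $\sum_{c\in Q_c}x_c\le 2(d+1)\log(4(d+1)T)$, where $Q_c$ is the set of complex configurations.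
   Context: $\log=\log_2$. Elements of $Q$ are called configurations. For a vector $a$, $\mathrm{supp}(a)=\{i: a_i\neq 0\}$. A configuration $c\in Q$ is simple if $|\mathrm{supp}(c)|\le\log(T+1)$ and complex otherwise. *)

theory Defs
  imports "HOL-Analysis.Analysis"
begin

definition supp :: "('i \<Rightarrow> 'a::zero) \<Rightarrow> 'i set" where
  "supp a = {i. a i \<noteq> 0}"

definition configs :: "real ^ 'd \<Rightarrow> nat \<Rightarrow> (real ^ 'd) set" where
  "configs p T = {c. \<forall>i. c $ i \<in> \<int>} \<inter> {c. (\<forall>i. 0 \<le> c $ i) \<and> p \<bullet> c \<le> real T}"

definition simple_config :: "nat \<Rightarrow> real ^ 'd \<Rightarrow> bool" where
  "simple_config T c \<longleftrightarrow> real (card (supp (vec_nth c))) \<le> log 2 (real T + 1)"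

definition complex_configs :: "real ^ 'd \<Rightarrow> nat \<Rightarrow> (real ^ 'd) set" where
  "complex_configs p T = {c \<in> configs p T. \<not> simple_config T c}"

text \<open>
  A vector indexed by the configurations is a function on all of \<^typ>\<open>real ^ 'd\<close> that
  vanishes off \<open>configs p T\<close>; thus \<open>supp x\<close> is its support as a vector. The sums below range
  over a finite set when \<open>p\<close> is positive (lemma \<open>finite_configs\<close>).
\<close>

definition conf_IP_solution ::
    "real ^ 'd \<Rightarrow> nat \<Rightarrow> real ^ 'd \<Rightarrow> nat \<Rightarrow> (real ^ 'd \<Rightarrow> nat) \<Rightarrow> bool" where
  "conf_IP_solution p T b m x \<longleftrightarrow>
     (\<forall>c. c \<notin> configs p T \<longrightarrow> x c = 0) \<and>
     (\<Sum>c\<in>configs p T. real (x c) *\<^sub>R c) = b \<and>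
     (\<Sum>c\<in>configs p T. x c) = m"

lemma finite_configs:
  fixes p :: "real ^ 'd"
  assumes pos: "\<And>i. 0 < p $ i"
  shows "finite (configs p T)"
proof -
  define B where "B = Max (range (\<lambda>i. real T / p $ i))"
  have "configs p T \<subseteq> vec_lambda ` {f. \<forall>i. f i \<in> {k \<in> \<int>. \<bar>k\<bar> \<le> B}}"
  proof
    fix c assume c: "c \<in> configs p T"
    have nn: "0 \<le> c $ i" for i using c by (simp add: configs_def)
    have "\<bar>c $ i\<bar> \<le> B" for i
    proof -
      have "p $ i * c $ i \<le> (\<Sum>j\<in>UNIV. p $ j * c $ j)"
        by (rule member_le_sum) (auto intro: mult_nonneg_nonneg less_imp_le pos nn)
      also have "\<dots> \<le> real T" using c by (simp add: configs_def inner_vec_def)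
      finally have "c $ i \<le> real T / p $ i" using pos[of i] by (simp add: field_simps)
      also have "\<dots> \<le> B" unfolding B_def by (rule Max_ge) auto
      finally show ?thesis using nn[of i] by simp
    qed
    then show "c \<in> vec_lambda ` {f. \<forall>i. f i \<in> {k \<in> \<int>. \<bar>k\<bar> \<le> B}}"
      using c by (intro image_eqI[where x = "vec_nth c"]) (auto simp: configs_def)
  qed
  moreover have "finite {f :: 'd \<Rightarrow> real. \<forall>i. f i \<in> {k \<in> \<int>. \<bar>k\<bar> \<le> B}}"
    using finite_PiE[of UNIV "\<lambda>_::'d. {k \<in> \<int>. \<bar>k\<bar> \<le> B}"] finite_abs_int_segment[of B]
    by (simp add: PiE_UNIV_domain Pi_def)
  ultimately show ?thesis by (meson finite_imageI finite_subset)
qed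

end

theory Submission
  imports Defs
begin

text \<open>
  Among all solutions take one that maximises \<open>\<Phi> x = (\<Sum>c. x c * (c \<bullet> c))\<close> and, among
  those, one with the smallest support. If a complex configuration \<open>c\<close> is used twice, the
  more than \<open>T + 1\<close> subsets of its support cannot all have different integral \<open>p\<close>-weights in \<open>{0..T}\<close>, so there is
  \<open>h \<noteq> 0\<close> such that \<open>c + h\<close> and \<open>c - h\<close> are configurations; replacing two copies of \<open>c\<close> by
  these increases \<open>\<Phi>\<close> by strict convexity. If the support is large, then, as in the argument of
  Eisenbrand and Shmonin, two of its subsets have the same cardinality and the same vector sum;
  shifting multiplicity from one to the other, in the direction that does not decrease \<open>\<Phi>\<close>,
  empties some configuration. This bounds the whole support by
  \<open>2 * (d + 1) * log 2 (4 * (d + 1) * T)\<close>, and complex configurations have multiplicity one.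
\<close>

section \<open>Pigeonhole and integrality\<close>

lemma subset_collision:
  assumes "finite A" "finite Y" "f ` Pow A \<subseteq> Y" "card Y < 2 ^ card A"
  obtains S S' where "S \<subseteq> A" "S' \<subseteq> A" "S \<noteq> S'" "f S = f S'"
proof -
  have "card (f ` Pow A) < card (Pow A)"
    using card_mono[OF assms(2,3)] assms(1,4) by (simp add: card_Pow)
  then have "\<not> inj_on f (Pow A)" by (rule pigeonhole)
  then show thesis using that by (auto simp: inj_on_def)
qed

text \<open>Pigeonhole needs finitely many natural codes, while weights and coordinates are real. A
  sum of nonnegative integers is recovered from its code, so equal codes mean equal sums.\<close>

lemma nat_floor_sum_inject:
  fixes f g :: "'a \<Rightarrow> real"
  assumes "\<And>i. i \<in> A \<Longrightarrow> f i \<in> \<int> \<and> 0 \<le> f i" "\<And>i. i \<in> B \<Longrightarrow> g i \<in> \<int> \<and> 0 \<le> g i"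
    and eq: "nat \<lfloor>sum f A\<rfloor> = nat \<lfloor>sum g B\<rfloor>"
  shows "sum f A = sum g B"
proof -
  have "sum f A \<in> \<int>" "sum g B \<in> \<int>" using assms(1,2) by blast+
  moreover have "0 \<le> sum f A" "0 \<le> sum g B" using assms(1,2) by (auto intro: sum_nonneg)
  ultimately show ?thesis using eq by (auto elim!: Ints_cases)
qed

text \<open>A positive integral weight is at least 1, so each coordinate is dominated by its own
  term of \<open>p \<bullet> c\<close>. The bound thus depends on \<open>T\<close> alone.\<close>

lemma config_component_le:
  fixes p :: "real ^ 'd"
  assumes p: "\<And>i. p $ i \<in> \<int> \<and> 0 < p $ i" and c: "c \<in> configs p T"
  shows "c $ i \<le> real T"
proof -
  have nn: "0 \<le> c $ j" for j using c by (simp add: configs_def)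
  have p1: "1 \<le> p $ j" for j
    using p[of j] by (auto simp: Ints_def)
  have "c $ i \<le> p $ i * c $ i" using mult_right_mono[OF p1 nn] by simp
  also have "\<dots> \<le> (\<Sum>j\<in>UNIV. p $ j * c $ j)"
    by (rule member_le_sum) (use p nn in \<open>auto intro: mult_nonneg_nonneg less_imp_le\<close>)
  also have "\<dots> \<le> real T" using c by (simp add: configs_def inner_vec_def)
  finally show ?thesis .
qed

section \<open>Splitting a complex configuration\<close>

lemma complex_config_split:
  fixes p :: "real ^ 'd"
  assumes p: "\<And>i. p $ i \<in> \<int> \<and> 0 < p $ i"
    and c: "c \<in> configs p T" and complex: "\<not> simple_config T c"
  obtains h where "h \<noteq> 0" "c + h \<in> configs p T" "c - h \<in> configs p T"
proof -
  let ?A = "supp (vec_nth c)"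
  have cint: "c $ i \<in> \<int>" and nn: "0 \<le> c $ i" for i using c by (auto simp: configs_def)
  have c1: "1 \<le> c $ i" if "i \<in> ?A" for i
    using that cint[of i] nn[of i] by (auto simp: Ints_def supp_def)
  have pc: "p \<bullet> c \<le> real T" using c by (simp add: configs_def)
  \<comment> \<open>As \<open>c\<close> is at least 1 on its support, subset weights are at most
    \<open>p \<bullet> c\<close>, which leaves the \<open>T + 1\<close> values in
    \<open>{..T}\<close>.\<close>
  have weight_le: "(\<Sum>i\<in>S. p $ i) \<le> real T" if "S \<subseteq> ?A" for S
  proof -
    have "(\<Sum>i\<in>S. p $ i) \<le> (\<Sum>i\<in>S. p $ i * c $ i)"
    proof (rule sum_mono)
      fix i assume "i \<in> S"
      then show "p $ i \<le> p $ i * c $ i"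
        using that c1 p[of i] by (auto simp: mult_le_cancel_left1)
    qed
    also have "\<dots> \<le> (\<Sum>i\<in>UNIV. p $ i * c $ i)"
      by (rule sum_mono2) (use p nn in \<open>auto intro: mult_nonneg_nonneg less_imp_le\<close>)
    also have "\<dots> \<le> real T" using pc by (simp add: inner_vec_def)
    finally show ?thesis .
  qed
  \<comment> \<open>Being complex is exactly the strict inequality the pigeonhole needs: more
    subsets than possible weights.\<close>
  have "real (T + 1) < 2 powr real (card ?A)"
    using complex by (simp add: simple_config_def not_le log_less_iff)
  then have "real (T + 1) < real (2 ^ card ?A)" by (simp add: powr_realpow)
  then have big: "card {..T} < 2 ^ card ?A" by (simp only: of_nat_less_iff card_atMost)
  have img: "(\<lambda>S. nat \<lfloor>\<Sum>i\<in>S. p $ i\<rfloor>) ` Pow ?A \<subseteq> {..T}"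
    using weight_le by (auto simp: nat_le_iff floor_le_iff) (smt (verit) of_nat_0_le_iff)
  obtain S S' where S: "S \<subseteq> ?A" "S' \<subseteq> ?A" "S \<noteq> S'"
    and eq: "nat \<lfloor>\<Sum>i\<in>S. p $ i\<rfloor> = nat \<lfloor>\<Sum>i\<in>S'. p $ i\<rfloor>"
    by (rule subset_collision[OF _ _ img big]) auto
  have weight_eq: "(\<Sum>i\<in>S. p $ i) = (\<Sum>i\<in>S'. p $ i)"
    by (rule nat_floor_sum_inject[OF _ _ eq]) (use p in \<open>auto intro: less_imp_le\<close>)
  \<comment> \<open>A difference of two indicators of equal weight is orthogonal to
    \<open>p\<close>, so moving along it in either direction keeps
    \<open>p \<bullet> c\<close>.\<close>
  define h :: "real ^ 'd" where "h = (\<chi> i. of_bool (i \<in> S) - of_bool (i \<in> S'))"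
  have h0: "h \<noteq> 0"
  proof
    assume "h = 0"
    then have "(of_bool (i \<in> S) :: real) = of_bool (i \<in> S')" for i
      by (simp add: h_def vec_eq_iff)
    then have "i \<in> S \<longleftrightarrow> i \<in> S'" for i by (simp only: of_bool_eq_iff)
    with S(3) show False by blast
  qed
  have "p \<bullet> h = (\<Sum>i\<in>UNIV. p $ i * of_bool (i \<in> S)) - (\<Sum>i\<in>UNIV. p $ i * of_bool (i \<in> S'))"
    by (simp add: h_def inner_vec_def right_diff_distrib sum_subtractf)
  also have "\<dots> = 0" using weight_eq by (simp add: of_bool_def if_distrib sum.If_cases)
  finally have ph: "p \<bullet> h = 0" .
  have hint: "h $ i \<in> \<int>" for i by (simp add: h_def)
  \<comment> \<open>Off the support \<open>h\<close> vanishes, on it \<open>c\<close> is at least 1;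
    this single bound keeps both \<open>c + h\<close> and \<open>c - h\<close> nonnegative.\<close>
  have hle: "\<bar>h $ i\<bar> \<le> c $ i" for i
    using S(1,2) c1[of i] nn[of i] by (auto simp: h_def)
  have "0 \<le> c $ i + h $ i" "0 \<le> c $ i - h $ i" for i using hle[of i] by linarith+
  then have "c + h \<in> configs p T" "c - h \<in> configs p T"
    using cint hint pc ph by (simp_all add: configs_def inner_add_right inner_diff_right)
  with h0 show thesis by (rule that)
qed

section \<open>Exchanges between configurations and the potential\<close>

text \<open>\<open>g\<close> is general so that one identity serves both the vector constraint
  (\<open>g\<close> the identity) and the potential (\<open>g c = c \<bullet> c\<close>).\<close>

lemma sum_shift:
  fixes g :: "'a \<Rightarrow> 'b::real_vector"
  assumes "\<And>a. a \<in> Q \<Longrightarrow> real (y a) = real (x a) + v a"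
  shows "(\<Sum>a\<in>Q. real (y a) *\<^sub>R g a) = (\<Sum>a\<in>Q. real (x a) *\<^sub>R g a) + (\<Sum>a\<in>Q. v a *\<^sub>R g a)"
  using assms by (simp add: scaleR_add_left sum.distrib)

text \<open>The change \<open>v\<close> is real because it takes negative values; that no
  multiplicity becomes negative is encoded in \<open>y\<close> being natural-valued.\<close>

lemma conf_IP_solution_shift:
  assumes x: "conf_IP_solution p T b m x"
    and y: "\<And>c. c \<in> configs p T \<Longrightarrow> real (y c) = real (x c) + v c"
    and off: "\<And>c. c \<notin> configs p T \<Longrightarrow> y c = 0"
    and v: "(\<Sum>c\<in>configs p T. v c *\<^sub>R c) = 0" "(\<Sum>c\<in>configs p T. v c) = 0"
  shows "conf_IP_solution p T b m y"
proof -
  have "real (\<Sum>c\<in>configs p T. y c) = real (\<Sum>c\<in>configs p T. x c)"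
    using y v(2) by (simp add: sum.distrib)
  then have "(\<Sum>c\<in>configs p T. y c) = (\<Sum>c\<in>configs p T. x c)" by linarith
  moreover have "(\<Sum>c\<in>configs p T. real (y c) *\<^sub>R c) = (\<Sum>c\<in>configs p T. real (x c) *\<^sub>R c)"
    using sum_shift[where g = "\<lambda>c. c" and y = y, OF y] v(1) by simp
  ultimately show ?thesis using x off by (simp add: conf_IP_solution_def)
qed

text \<open>Scalar multiplication replaces the product of reals to make this an instance of
  \<open>sum_shift\<close>.\<close>

definition sq_potential :: "real ^ 'd \<Rightarrow> nat \<Rightarrow> (real ^ 'd \<Rightarrow> nat) \<Rightarrow> real" where
  "sq_potential p T x = (\<Sum>c\<in>configs p T. real (x c) *\<^sub>R (c \<bullet> c))"

lemma increase_potential: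
  fixes p :: "real ^ 'd"
  assumes p: "\<And>i. p $ i \<in> \<int> \<and> 0 < p $ i" and x: "conf_IP_solution p T b m x"
    and two: "1 < x c" and complex: "\<not> simple_config T c"
  obtains y where "conf_IP_solution p T b m y" "sq_potential p T x < sq_potential p T y"
proof -
  let ?Q = "configs p T"
  have fin: "finite ?Q" using p finite_configs by blast
  have c: "c \<in> ?Q" using x two by (auto simp: conf_IP_solution_def)
  obtain h where h: "h \<noteq> 0" "c + h \<in> ?Q" "c - h \<in> ?Q"
    by (rule complex_config_split[OF p c complex])
  define v :: "real ^ 'd \<Rightarrow> real" where
    "v a = of_bool (a = c + h) + of_bool (a = c - h) - 2 * of_bool (a = c)" for a
  \<comment> \<open>The truncated subtraction is exact, since \<open>x c\<close> is at least
    2.\<close>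
  define y where "y a = x a + of_bool (a = c + h) + of_bool (a = c - h) - 2 * of_bool (a = c)" for a
  have y: "real (y a) = real (x a) + v a" for a
    using two by (auto simp: y_def v_def)
  have vsum: "(\<Sum>a\<in>?Q. v a *\<^sub>R g a) = g (c + h) + g (c - h) - 2 *\<^sub>R g c"
    for g :: "real ^ 'd \<Rightarrow> 'b::real_vector"
  proof -
    have one: "(\<Sum>a\<in>?Q. of_bool (a = e) *\<^sub>R g a) = g e" if "e \<in> ?Q" for e
      using that fin
      by (simp add: of_bool_def if_distrib[of "\<lambda>r. r *\<^sub>R _"] cong: if_cong)
    have "(\<Sum>a\<in>?Q. v a *\<^sub>R g a) = (\<Sum>a\<in>?Q. of_bool (a = c + h) *\<^sub>R g a)
      + (\<Sum>a\<in>?Q. of_bool (a = c - h) *\<^sub>R g a) - 2 *\<^sub>R (\<Sum>a\<in>?Q. of_bool (a = c) *\<^sub>R g a)"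
      by (simp add: v_def scaleR_diff_left scaleR_add_left sum.distrib sum_subtractf
          scaleR_sum_right)
    then show ?thesis using one c h by simp
  qed
  have "conf_IP_solution p T b m y"
  proof (rule conf_IP_solution_shift[OF x y])
    show "y a = 0" if "a \<notin> ?Q" for a
      using that x h c by (auto simp: y_def conf_IP_solution_def)
    show "(\<Sum>a\<in>?Q. v a *\<^sub>R a) = 0" using vsum[of "\<lambda>a. a"] by (simp add: scaleR_2)
    show "(\<Sum>a\<in>?Q. v a) = 0" using vsum[of "\<lambda>_. 1::real"] by simp
  qed
  \<comment> \<open>Parallelogram law: the squared norms of \<open>c + h\<close> and
    \<open>c - h\<close> exceed twice that of \<open>c\<close> by
    \<open>2 * (h \<bullet> h)\<close>.\<close>
  moreover have "sq_potential p T y = sq_potential p T x + 2 * (h \<bullet> h)"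
    unfolding sq_potential_def sum_shift[OF y] vsum
    by (simp add: inner_add_left inner_add_right inner_diff_left inner_diff_right)
  ultimately show thesis using h(1) by (intro that) auto
qed

section \<open>Emptying a configuration\<close>

lemma shrink_support_directed:
  fixes p :: "real ^ 'd"
  assumes fin: "finite (configs p T)" and x: "conf_IP_solution p T b m x"
    and S: "S \<subseteq> supp x" "S' \<subseteq> supp x" "S \<noteq> S'" "card S = card S'"
    and sums: "(\<Sum>c\<in>S. c) = (\<Sum>c\<in>S'. c)"
    and le: "(\<Sum>c\<in>S'. c \<bullet> c) \<le> (\<Sum>c\<in>S. c \<bullet> c)"
  shows "\<exists>y. conf_IP_solution p T b m y \<and> sq_potential p T x \<le> sq_potential p T y
    \<and> card (supp y) < card (supp x)"
proof -
  let ?Q = "configs p T"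
  have sQ: "supp x \<subseteq> ?Q" using x by (auto simp: conf_IP_solution_def supp_def)
  have fs: "finite (supp x)" using sQ fin finite_subset by blast
  \<comment> \<open>Were \<open>S'\<close> inside \<open>S\<close>, equal cardinality would make
    them equal.\<close>
  have "S' - S \<noteq> {}" using S fs by (metis Diff_eq_empty_iff card_subset_eq finite_subset)
  moreover have fin': "finite (S' - S)" using S fs by (meson finite_Diff finite_subset)
  \<comment> \<open>Removing \<open>x e\<close> copies from every member of \<open>S' - S\<close> is
    possible by minimality and empties \<open>e\<close>; members of both sets keep their
    multiplicity.\<close>
  ultimately obtain e where e: "e \<in> S' - S" and min: "\<And>a. a \<in> S' - S \<Longrightarrow> x e \<le> x a"
    by (metis arg_min_if_finite(1) arg_min_least)
  define v :: "real ^ 'd \<Rightarrow> real" where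
    "v a = real (x e) * (of_bool (a \<in> S) - of_bool (a \<in> S'))" for a
  define y where "y a = (if a \<in> S' - S then x a - x e else if a \<in> S - S' then x a + x e else x a)"
    for a
  have y: "real (y a) = real (x a) + v a" for a
    using min[of a] by (auto simp: y_def v_def)
  have vsum: "(\<Sum>a\<in>?Q. v a *\<^sub>R g a) = real (x e) *\<^sub>R ((\<Sum>a\<in>S. g a) - (\<Sum>a\<in>S'. g a))"
    for g :: "real ^ 'd \<Rightarrow> 'b::real_vector"
  proof -
    have ind: "(\<Sum>a\<in>?Q. of_bool (a \<in> R) *\<^sub>R g a) = (\<Sum>a\<in>R. g a)" if "R \<subseteq> supp x" for R
    proof -
      have "(\<Sum>a\<in>?Q. of_bool (a \<in> R) *\<^sub>R g a) = (\<Sum>a\<in>?Q. if a \<in> R then g a else 0)"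
        by (rule sum.cong) auto
      also have "\<dots> = (\<Sum>a\<in>R. g a)"
        using that sQ fin by (simp add: sum.inter_restrict[symmetric] Int_absorb1)
      finally show ?thesis .
    qed
    have "(\<Sum>a\<in>?Q. v a *\<^sub>R g a) = real (x e) *\<^sub>R
      ((\<Sum>a\<in>?Q. of_bool (a \<in> S) *\<^sub>R g a) - (\<Sum>a\<in>?Q. of_bool (a \<in> S') *\<^sub>R g a))"
      by (simp add: v_def scaleR_diff_left sum_subtractf scaleR_sum_right scaleR_diff_right
          right_diff_distrib)
    then show ?thesis using ind S by simp
  qed
  have suppy: "supp y \<subset> supp x"
  proof
    show "supp y \<subseteq> supp x" using S by (auto simp: y_def supp_def split: if_splits)
    have "e \<in> supp x" "e \<notin> supp y" using e S by (auto simp: y_def supp_def)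
    then show "supp y \<noteq> supp x" by blast
  qed
  have "conf_IP_solution p T b m y"
  proof (rule conf_IP_solution_shift[OF x y])
    show "y a = 0" if "a \<notin> ?Q" for a
      using that suppy sQ by (auto simp: supp_def)
    show "(\<Sum>a\<in>?Q. v a *\<^sub>R a) = 0" using vsum[of "\<lambda>a. a"] sums by simp
    show "(\<Sum>a\<in>?Q. v a) = 0" using vsum[of "\<lambda>_. 1::real"] S(4) by simp
  qed
  moreover have "sq_potential p T x \<le> sq_potential p T y"
    unfolding sq_potential_def sum_shift[OF y] vsum using le by simp
  moreover have "card (supp y) < card (supp x)" using suppy fs by (rule psubset_card_mono[rotated])
  ultimately show ?thesis by blast
qed

text \<open>All hypotheses are symmetric in \<open>S\<close> and \<open>S'\<close>, so the roles can
  be chosen to suit the potential.\<close>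

lemma shrink_support:
  fixes p :: "real ^ 'd"
  assumes fin: "finite (configs p T)" and x: "conf_IP_solution p T b m x"
    and S: "S \<subseteq> supp x" "S' \<subseteq> supp x" "S \<noteq> S'" "card S = card S'"
    and sums: "(\<Sum>c\<in>S. c) = (\<Sum>c\<in>S'. c)"
  obtains y where "conf_IP_solution p T b m y" "sq_potential p T x \<le> sq_potential p T y"
    "card (supp y) < card (supp x)"
proof (cases "(\<Sum>c\<in>S'. c \<bullet> c) \<le> (\<Sum>c\<in>S. c \<bullet> c)")
  case True
  from shrink_support_directed[OF fin x S sums this] show thesis using that by auto
next
  case False
  then have "(\<Sum>c\<in>S. c \<bullet> c) \<le> (\<Sum>c\<in>S'. c \<bullet> c)" by simp
  from shrink_support_directed[OF fin x S(2,1) S(3)[symmetric] S(4)[symmetric] sums[symmetric] this]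
  show thesis using that by auto
qed

section \<open>Counting bound on the support\<close>

text \<open>Taking logarithms leaves \<open>k\<close> on both sides. Since
  \<open>log 2 u \<le> u\<close> for \<open>u = k / (2 * n)\<close>, the occurrence on the right
  costs only \<open>k / 2\<close>, which the left side absorbs.\<close>

lemma support_bound_arith:
  fixes k n T :: nat
  assumes k: "2 ^ k \<le> (k * T + 1) ^ n" and n: "0 < n" and T: "0 < T"
  shows "real k \<le> 2 * real n * log 2 (4 * real n * real T)"
\<comment> \<open>\<open>k = 0\<close> is separate because \<open>k * T + 1 \<le> 2 * k * T\<close>
  and the logarithm of \<open>u\<close> need \<open>k\<close> positive.\<close>
proof (cases "k = 0")
  case True
  have "1 \<le> real n * real T" using n T by (simp flip: of_nat_mult)
  then have "0 \<le> log 2 (4 * real n * real T)"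
    by (subst zero_le_log_cancel_iff) (use n T in \<open>simp_all add: mult.assoc\<close>)
  then show ?thesis using True by simp
next
  case False
  define u where "u = real k / (2 * real n)"
  have u: "0 < u" using False n by (simp add: u_def)
  have "real k = log 2 (real (2 ^ k))" by simp
  also have "\<dots> \<le> log 2 (real ((k * T + 1) ^ n))"
    using k by (subst log_le_cancel_iff) (simp_all del: of_nat_power)
  also have "\<dots> = real n * log 2 (real (k * T + 1))" by (simp add: log_nat_power del: of_nat_add of_nat_mult)
  also have "\<dots> \<le> real n * log 2 (real (2 * k * T))"
  proof -
    have "1 \<le> k * T" using False T by simp
    then have "real (k * T + 1) \<le> real (2 * k * T)" by (simp only: of_nat_le_iff)
    then have "log 2 (real (k * T + 1)) \<le> log 2 (real (2 * k * T))"
      using False T by (subst log_le_cancel_iff) (auto intro: add_pos_nonneg)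
    then show ?thesis by (rule mult_left_mono) simp
  qed
  also have "real (2 * k * T) = (4 * real n * real T) * u" using n by (simp add: u_def)
  also have "log 2 \<dots> = log 2 (4 * real n * real T) + log 2 u"
    using u n T by (subst log_mult) auto
  also have "log 2 u \<le> u"
  proof -
    have "u \<le> real (Suc (nat \<lfloor>u\<rfloor>))" using u by linarith
    also have "\<dots> \<le> real (2 ^ nat \<lfloor>u\<rfloor>)" by (simp only: of_nat_le_iff Suc_le_eq less_exp)
    also have "\<dots> = 2 powr real (nat \<lfloor>u\<rfloor>)" by (simp add: powr_realpow)
    also have "\<dots> \<le> 2 powr u" using u by (intro powr_mono) auto
    finally have "u \<le> 2 powr u" .
    then show ?thesis using u by (simp add: log_le_iff)
  qed
  finally have "real k \<le> real n * (log 2 (4 * real n * real T) + u)" by (simp add: mult_left_mono)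
  then show ?thesis using n by (simp add: u_def field_simps)
qed

lemma large_support_collision:
  fixes p :: "real ^ 'd"
  assumes p: "\<And>i. p $ i \<in> \<int> \<and> 0 < p $ i" and T: "0 < T" and K: "K \<subseteq> configs p T"
    and large: "2 * (real CARD('d) + 1) * log 2 (4 * (real CARD('d) + 1) * real T) < real (card K)"
  obtains S S' where "S \<subseteq> K" "S' \<subseteq> K" "S \<noteq> S'" "card S = card S'" "(\<Sum>c\<in>S. c) = (\<Sum>c\<in>S'. c)"
proof -
  let ?k = "card K"
  have fK: "finite K" using finite_configs[of p T] p K finite_subset by blast
  \<comment> \<open>Codes of subsets: \<open>d\<close> coordinate sums, each at most
    \<open>?k * T\<close>, together with the cardinality.\<close>
  define Y where "Y = ((UNIV::'d set) \<rightarrow>\<^sub>E {..?k * T}) \<times> {..?k}"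
  have fY: "finite Y" by (simp add: Y_def finite_PiE)
  have "card Y = (?k * T + 1) ^ CARD('d) * (?k + 1)"
    by (simp add: Y_def card_PiE card_cartesian_product)
  \<comment> \<open>Since \<open>T\<close> is positive, the cardinality can be counted like one more
    coordinate, whence the \<open>d + 1\<close>.\<close>
  also have "\<dots> \<le> (?k * T + 1) ^ CARD('d) * (?k * T + 1)"
    using T by (intro mult_left_mono) auto
  also have "\<dots> = (?k * T + 1) ^ (CARD('d) + 1)" by simp
  also have "\<dots> < 2 ^ ?k"
    using support_bound_arith[of ?k T "CARD('d) + 1"] T large by (force simp: add.commute)
  finally have big: "card Y < 2 ^ ?k" .
  have cint: "c $ i \<in> \<int>" and nn: "0 \<le> c $ i" if "c \<in> K" for c i
    using K that by (auto simp: configs_def)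
  have le: "(\<Sum>c\<in>S. c $ i) \<le> real (?k * T)" if "S \<subseteq> K" for S i
  proof -
    have "(\<Sum>c\<in>S. c $ i) \<le> real (card S) * real T"
      using config_component_le[OF p] that K by (intro sum_bounded_above) blast
    also have "\<dots> \<le> real ?k * real T"
      using card_mono[OF fK that] by (intro mult_right_mono) auto
    finally show ?thesis by simp
  qed
  define f where "f S = ((\<lambda>i. nat \<lfloor>\<Sum>c\<in>S. c $ i\<rfloor>), card S)" for S :: "(real ^ 'd) set"
  have img: "f ` Pow K \<subseteq> Y"
  proof (rule image_subsetI)
    fix S assume "S \<in> Pow K"
    then have S: "S \<subseteq> K" by simp
    have "nat \<lfloor>\<Sum>c\<in>S. c $ i\<rfloor> \<le> ?k * T" for i
      using le[OF S, of i] by linarith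
    then show "f S \<in> Y"
      using card_mono[OF fK S] by (auto simp: f_def Y_def)
  qed
  obtain S S' where S: "S \<subseteq> K" "S' \<subseteq> K" "S \<noteq> S'" and eq: "f S = f S'"
    by (rule subset_collision[OF fK fY img big])
  have "(\<Sum>c\<in>S. c) $ i = (\<Sum>c\<in>S'. c) $ i" for i
  proof -
    have "nat \<lfloor>\<Sum>c\<in>S. c $ i\<rfloor> = nat \<lfloor>\<Sum>c\<in>S'. c $ i\<rfloor>"
      using eq by (auto simp: f_def dest: fun_cong)
    then have "(\<Sum>c\<in>S. c $ i) = (\<Sum>c\<in>S'. c $ i)"
      by (rule nat_floor_sum_inject[rotated 2]) (use S cint nn in auto)
    then show ?thesis by simp
  qed
  then have "(\<Sum>c\<in>S. c) = (\<Sum>c\<in>S'. c)" by (simp add: vec_eq_iff)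
  moreover have "card S = card S'" using eq by (simp add: f_def)
  ultimately show thesis using S that by blast
qed

section \<open>Choosing the extremal solution\<close>

text \<open>Each multiplicity is at most the total \<open>m\<close>. Finiteness ensures that the
  potential attains a maximum.\<close>

lemma finite_conf_IP_solutions:
  assumes fin: "finite (configs p T)"
  shows "finite {x. conf_IP_solution p T b m x}"
proof (rule finite_subset)
  show "finite {x. \<forall>c. (c \<in> configs p T \<longrightarrow> x c \<in> {..m}) \<and> (c \<notin> configs p T \<longrightarrow> x c = 0)}"
    by (rule finite_set_of_finite_funs) (use fin in auto)
  show "{x. conf_IP_solution p T b m x}
    \<subseteq> {x. \<forall>c. (c \<in> configs p T \<longrightarrow> x c \<in> {..m}) \<and> (c \<notin> configs p T \<longrightarrow> x c = 0)}"
    using fin by (auto simp: conf_IP_solution_def intro: member_le_sum)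
qed

theorem theorem1:
  fixes p b :: "real ^ 'd" and T m :: nat
  assumes "\<And>i. p $ i \<in> \<int> \<and> 0 < p $ i"
    and "0 < T"
    and "\<exists>x. conf_IP_solution p T b m x"
  shows "\<exists>x. conf_IP_solution p T b m x
    \<and> (\<forall>c. 1 < x c \<longrightarrow> simple_config T c)
    \<and> real (card (supp x))
        \<le> 4 * (real CARD('d) + 1) * log 2 (4 * (real CARD('d) + 1) * real T)
    \<and> real (\<Sum>c\<in>complex_configs p T. x c)
        \<le> 2 * (real CARD('d) + 1) * log 2 (4 * (real CARD('d) + 1) * real T)"
proof -
  let ?Q = "configs p T" and ?\<Phi> = "sq_potential p T"
  let ?L = "2 * (real CARD('d) + 1) * log 2 (4 * (real CARD('d) + 1) * real T)"
  let ?Sol = "{x. conf_IP_solution p T b m x}"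
  have fin: "finite ?Q" using assms(1) finite_configs by blast
  have sols: "finite ?Sol" "?Sol \<noteq> {}"
    using finite_conf_IP_solutions[OF fin] assms(3) by auto
  then have "Max (?\<Phi> ` ?Sol) \<in> ?\<Phi> ` ?Sol" by (intro Max_in) auto
  then obtain x0 where x0: "conf_IP_solution p T b m x0" and "?\<Phi> x0 = Max (?\<Phi> ` ?Sol)"
    by auto
  then have max0: "?\<Phi> y \<le> ?\<Phi> x0" if "conf_IP_solution p T b m y" for y
    using sols(1) that by simp
  \<comment> \<open>By maximality of \<open>x0\<close>, the condition
    \<open>?\<Phi> x0 \<le> ?\<Phi> y\<close> singles out the maximisers.\<close>
  obtain x where x: "conf_IP_solution p T b m x" and "?\<Phi> x0 \<le> ?\<Phi> x"
    and min: "\<And>y. conf_IP_solution p T b m y \<Longrightarrow> ?\<Phi> x0 \<le> ?\<Phi> y \<Longrightarrow> card (supp x) \<le> card (supp y)"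
    using ex_has_least_nat[of "\<lambda>y. conf_IP_solution p T b m y \<and> ?\<Phi> x0 \<le> ?\<Phi> y" x0 "\<lambda>y. card (supp y)"]
      x0 by auto
  then have max: "?\<Phi> y \<le> ?\<Phi> x" if "conf_IP_solution p T b m y" for y
    using max0[OF that] by linarith
  have simple: "simple_config T c" if "1 < x c" for c
  proof (rule ccontr)
    assume "\<not> simple_config T c"
    then obtain y where "conf_IP_solution p T b m y" "?\<Phi> x < ?\<Phi> y"
      by (rule increase_potential[OF assms(1) x \<open>1 < x c\<close>])
    with max[of y] show False by simp
  qed
  have sQ: "supp x \<subseteq> ?Q" using x by (auto simp: conf_IP_solution_def supp_def)
  have supp_le: "real (card (supp x)) \<le> ?L"
  proof (rule ccontr)
    assume "\<not> ?thesis"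
    then have large: "?L < real (card (supp x))" by (simp only: not_le)
    obtain S S' where "S \<subseteq> supp x" "S' \<subseteq> supp x" "S \<noteq> S'" "card S = card S'"
      "(\<Sum>c\<in>S. c) = (\<Sum>c\<in>S'. c)"
      by (rule large_support_collision[OF assms(1,2) sQ large])
    then obtain y where "conf_IP_solution p T b m y" "?\<Phi> x \<le> ?\<Phi> y" "card (supp y) < card (supp x)"
      by (rule shrink_support[OF fin x])
    with min[of y] \<open>?\<Phi> x0 \<le> ?\<Phi> x\<close> show False by simp
  qed
  \<comment> \<open>Complex configurations have multiplicity at most one, so their total only counts
    members of the support.\<close>
  have "(\<Sum>c\<in>complex_configs p T. x c) \<le> (\<Sum>c\<in>complex_configs p T. of_bool (c \<in> supp x))"
  proof (rule sum_mono)
    fix c assume "c \<in> complex_configs p T"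
    then have "\<not> 1 < x c" using simple by (auto simp: complex_configs_def)
    then show "x c \<le> of_bool (c \<in> supp x)" by (auto simp: supp_def)
  qed
  also have "\<dots> = card (complex_configs p T \<inter> supp x)"
    using fin by (simp add: complex_configs_def of_bool_def sum.If_cases)
  also have "\<dots> \<le> card (supp x)"
    using sQ fin by (intro card_mono) (auto intro: finite_subset)
  finally have "real (\<Sum>c\<in>complex_configs p T. x c) \<le> ?L"
    using supp_le by linarith
  \<comment> \<open>Doubling is harmless: \<open>?L\<close> bounds a cardinality, hence is
    nonnegative.\<close>
  moreover have "real (card (supp x)) \<le> 2 * ?L" using supp_le by linarith
  then have "real (card (supp x))
      \<le> 4 * (real CARD('d) + 1) * log 2 (4 * (real CARD('d) + 1) * real T)"
    by (simp only: mult.assoc [symmetric])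
  ultimately show ?thesis using x simple by blast
qed

end
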